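(* Let $A$ be an atomic domain. Then $A$ is a half-factorial domain (HFD) if and only if every nonzero prime ideal of $A$ contains a good atom of $A$.
   Context: Domain means (commutative) integral domain. An atom (irreducible element) of a domain $A$ is a nonzero nonunit that is not a product of two nonunits of $A$. $A$ is atomic if every nonzero nonunit of $A$ is a product of finitely many atoms. $A$ is a half-factorial domain (HFD) if $A$ is atomic and, for each nonzero nonunit $x\in A$, all factorizations of $x$ into atoms have the same length (number of factors). Let $A$ be an atomic domain. An atomic equality is an equality $a_1\cdots a_n=b_1\cdots b_m$ in which all factors $a_i,b_j$ are atoms of $A$ ($n,m\ge 1$). It is balanced if $n=m$ and unbalanced if $n\ne m$. It is irredundant if no proper subproduct of the $a$'s is associated to a proper subproduct of the $b$'s, i.e. $\prod_{i\in I}a_i$ is not associated (equal up to a unit factor of $A$) to $\prod_{j\in J}b_j$ for all nonempty proper subsets $I\subsetneq\{1,\dots,n\}$, $J\subsetneq\{1,\dots,m\}$. A bad atom is an atom that appears (as one of the $a_i$ or $b_j$) in some irredundant unbalanced atomic equality. A good atom is an atom that is not bad. *)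

theory Defs
  imports "HOL-Algebra.Ring_Divisibility"
begin

text \<open>
  The predicate \<open>ring_irreducible\<close> alone does not bound its argument to the carrier. In a
  domain it says ``nonzero, nonunit, and not a product of two nonunits''
  (\<open>ring_irreducibleE\<close>, \<open>ring_irreducibleI\<close>).
\<close>

definition atoms :: "('a, 'b) ring_scheme \<Rightarrow> 'a set"
  where "atoms R = {a \<in> carrier R. ring_irreducible\<^bsub>R\<^esub> a}"

definition subproduct :: "('a, 'b) ring_scheme \<Rightarrow> 'a list \<Rightarrow> nat set \<Rightarrow> 'a"
  where "subproduct R as I = (\<Otimes>\<^bsub>R\<^esub>i\<in>I. as ! i)"

definition atomic_factorization :: "('a, 'b) ring_scheme \<Rightarrow> 'a list \<Rightarrow> 'a \<Rightarrow> bool"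
  where "atomic_factorization R as x \<longleftrightarrow>
    set as \<subseteq> atoms R \<and> subproduct R as {..<length as} = x"

locale atomic_domain = domain +
  assumes atomic_factorization_exists:
    "\<lbrakk>x \<in> carrier R; x \<noteq> \<zero>; x \<notin> Units R\<rbrakk> \<Longrightarrow> \<exists>as. atomic_factorization R as x"

locale half_factorial_domain = atomic_domain +
  assumes factorization_length_unique:
    "\<lbrakk>x \<in> carrier R; x \<noteq> \<zero>; x \<notin> Units R;
      atomic_factorization R as x; atomic_factorization R bs x\<rbrakk> \<Longrightarrow> length as = length bs"

definition atomic_equality :: "('a, 'b) ring_scheme \<Rightarrow> 'a list \<Rightarrow> 'a list \<Rightarrow> bool"
  where "atomic_equality R as bs \<longleftrightarrow>
    as \<noteq> [] \<and> bs \<noteq> [] \<and> set as \<subseteq> atoms R \<and> set bs \<subseteq> atoms R \<and>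
    subproduct R as {..<length as} = subproduct R bs {..<length bs}"

definition balanced :: "'a list \<Rightarrow> 'a list \<Rightarrow> bool"
  where "balanced as bs \<longleftrightarrow> length as = length bs"

text \<open>
  Subproducts are indexed by sets of positions, so repeated factors are counted with
  multiplicity. Both index sets are required to be nonempty and proper.
\<close>

definition irredundant :: "('a, 'b) ring_scheme \<Rightarrow> 'a list \<Rightarrow> 'a list \<Rightarrow> bool"
  where "irredundant R as bs \<longleftrightarrow>
    (\<forall>I J. I \<noteq> {} \<and> I \<subset> {..<length as} \<and> J \<noteq> {} \<and> J \<subset> {..<length bs} \<longrightarrow>
      \<not> subproduct R as I \<sim>\<^bsub>R\<^esub> subproduct R bs J)"

definition bad_atom :: "('a, 'b) ring_scheme \<Rightarrow> 'a \<Rightarrow> bool"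
  where "bad_atom R a \<longleftrightarrow>
    (\<exists>as bs. atomic_equality R as bs \<and> irredundant R as bs \<and> \<not> balanced as bs \<and>
      a \<in> set as \<union> set bs)"

definition good_atom :: "('a, 'b) ring_scheme \<Rightarrow> 'a \<Rightarrow> bool"
  where "good_atom R a \<longleftrightarrow> a \<in> atoms R \<and> \<not> bad_atom R a"

end

theory Submission
  imports Defs
begin

text \<open>
  An atomic equality whose left-hand side consists of good atoms is balanced: split it along
  associated proper subproducts until the pieces are irredundant; each piece contains a good
  atom, so each piece is balanced. If every nonzero prime ideal contains a good atom, then
  no nonzero principal ideal is disjoint from the multiplicative set of products of good atoms,
  since an ideal containing it and maximal with this property would be prime. So every nonzero
  nonunit \<open>x\<close> satisfies \<open>x y = g\<^sub>1 \<cdots> g\<^sub>k\<close> with good atoms \<open>g\<^sub>i\<close>. Appending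
  a fixed factorization of \<open>y\<close> to any factorization of \<open>x\<close> gives length \<open>k\<close>, hence all
  factorizations of \<open>x\<close> have the same length. Conversely, a half-factorial domain has no
  unbalanced atomic equality at all, so all its atoms are good.
\<close>

subsection \<open>Subproducts\<close>

context cring
begin

lemma subproduct_closed:
  assumes "set xs \<subseteq> carrier R" "I \<subseteq> {..<length xs}"
  shows "subproduct R xs I \<in> carrier R"
  unfolding subproduct_def using assms by (intro finprod_closed) (auto simp: subset_iff)

lemma subproduct_empty [simp]: "subproduct R xs {} = \<one>"
  by (simp add: subproduct_def)

lemma subproduct_Cons:
  assumes "x \<in> carrier R" "set xs \<subseteq> carrier R"
  shows "subproduct R (x # xs) {..<length (x # xs)} = x \<otimes> subproduct R xs {..<length xs}"
proof -
  let ?f = "\<lambda>i. (x # xs) ! i"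
  have nth: "xs ! i \<in> carrier R" if "i < length xs" for i
    using assms(2) that by (auto simp: subset_iff)
  have f: "?f \<in> {..<length (x # xs)} \<rightarrow> carrier R"
    using assms(1) nth by (auto simp: nth_Cons split: nat.splits)
  \<comment> \<open>Index 0 is split off; reindexing along \<open>Suc\<close> then shifts the other
    positions down onto those of \<open>xs\<close>.\<close>
  have "finprod R ?f {..<length (x # xs)} = finprod R ?f (insert 0 (Suc ` {..<length xs}))"
    by (simp add: lessThan_Suc_eq_insert_0)
  also have "\<dots> = ?f 0 \<otimes> finprod R ?f (Suc ` {..<length xs})"
    using assms(1) nth by (intro finprod_insert) auto
  also have "finprod R ?f (Suc ` {..<length xs}) = finprod R (\<lambda>i. ?f (Suc i)) {..<length xs}"
    using nth by (intro finprod_reindex) auto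
  finally show ?thesis
    by (simp add: subproduct_def)
qed

lemma subproduct_append:
  assumes "set xs \<subseteq> carrier R" "set ys \<subseteq> carrier R"
  shows "subproduct R (xs @ ys) {..<length (xs @ ys)} =
    subproduct R xs {..<length xs} \<otimes> subproduct R ys {..<length ys}"
  using assms(1)
proof (induction xs)
  case Nil
  then show ?case
    using subproduct_closed[OF assms(2), of "{..<length ys}"] by simp
next
  case (Cons x xs)
  then have x: "x \<in> carrier R" "set xs \<subseteq> carrier R"
    by auto
  have "subproduct R (x # (xs @ ys)) {..<length (x # (xs @ ys))} =
      x \<otimes> subproduct R (xs @ ys) {..<length (xs @ ys)}"
    using x assms(2) by (intro subproduct_Cons) auto
  also have "\<dots> = x \<otimes> (subproduct R xs {..<length xs} \<otimes> subproduct R ys {..<length ys})"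
    using Cons.IH x by simp
  also have "\<dots> = subproduct R (x # xs) {..<length (x # xs)} \<otimes> subproduct R ys {..<length ys}"
    unfolding subproduct_Cons[OF x]
    using x assms(2) by (simp add: m_assoc subproduct_closed)
  finally show ?case
    by simp
qed

lemma subproduct_Un_complement:
  assumes "set xs \<subseteq> carrier R" "I \<subseteq> {..<length xs}"
  shows "subproduct R xs {..<length xs} =
    subproduct R xs I \<otimes> subproduct R xs ({..<length xs} - I)"
proof -
  have "finite I"
    using assms(2) finite_subset by blast
  then have "finprod R ((!) xs) (I \<union> ({..<length xs} - I)) =
      finprod R ((!) xs) I \<otimes> finprod R ((!) xs) ({..<length xs} - I)"
    using assms by (intro finprod_Un_disjoint) (auto simp: subset_iff)
  moreover have "I \<union> ({..<length xs} - I) = {..<length xs}"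
    using assms(2) by auto
  ultimately show ?thesis
    by (simp add: subproduct_def)
qed

text \<open>Enumerating the chosen positions turns a subproduct back into a list of factors, so that
  an induction over lists can be applied to the pieces of a split equality.\<close>

lemma subproduct_as_list:
  assumes "set xs \<subseteq> carrier R" "I \<subseteq> {..<length xs}"
  obtains ys where "length ys = card I" "set ys \<subseteq> set xs"
    "subproduct R ys {..<length ys} = subproduct R xs I"
proof -
  have "finite I"
    using assms(2) finite_subset by blast
  then obtain h where h: "bij_betw h {..<card I} I"
    using ex_bij_betw_nat_finite[of I] by (auto simp: atLeast0LessThan)
  define ys where "ys = map (\<lambda>k. xs ! h k) [0..<card I]"
  have len: "length ys = card I"
    by (simp add: ys_def)
  have hI: "h k \<in> I" if "k < card I" for k
    using h that by (auto simp: bij_betw_def)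
  have sub: "set ys \<subseteq> set xs"
    using hI assms(2) by (auto simp: ys_def subset_iff)
  have "finprod R ((!) ys) {..<card I} = finprod R (\<lambda>k. xs ! h k) {..<card I}"
    using hI assms by (intro finprod_cong') (auto simp: ys_def subset_iff)
  also have "\<dots> = finprod R ((!) xs) (h ` {..<card I})"
    using h hI assms by (intro finprod_reindex[symmetric]) (auto simp: bij_betw_def subset_iff)
  also have "h ` {..<card I} = I"
    using h by (simp add: bij_betw_def)
  finally have "subproduct R ys {..<length ys} = subproduct R xs I"
    by (simp add: subproduct_def len)
  with len sub that show ?thesis
    by blast
qed

end

subsection \<open>Prime ideals and multiplicative sets\<close>

text \<open>Krull's argument: Zorn's lemma gives an ideal maximal among those that contain
  \<open>J\<close> and avoid \<open>S\<close>, and the multiplicativity of \<open>S\<close> forces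
  this ideal to be prime.\<close>

lemma (in cring) exists_primeideal_disjoint:
  assumes "ideal J R" "J \<inter> S = {}" "S \<subseteq> carrier R" "\<one> \<in> S"
    and S_mult: "\<And>s t. \<lbrakk>s \<in> S; t \<in> S\<rbrakk> \<Longrightarrow> s \<otimes> t \<in> S"
  obtains P where "primeideal P R" "J \<subseteq> P" "P \<inter> S = {}"
proof -
  let ?A = "{I. ideal I R \<and> J \<subseteq> I \<and> I \<inter> S = {}}"
  have "\<exists>M\<in>?A. \<forall>X\<in>?A. M \<subseteq> X \<longrightarrow> X = M"
  proof (rule subset_Zorn_nonempty)
    show "?A \<noteq> {}"
      using assms(1,2) by blast
    fix C assume C: "C \<noteq> {}" "subset.chain ?A C"
    have "C \<subseteq> ?A"
      using C(2) by (simp add: pred_on.chain_def)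
    then have "subset.chain {I. ideal I R} C"
      using C(2) by (auto simp: pred_on.chain_def)
    then have "ideal (\<Union>C) R"
      using chain_Union_is_ideal[of C] C(1) by simp
    moreover have "J \<subseteq> \<Union>C" "\<Union>C \<inter> S = {}"
      using C(1) \<open>C \<subseteq> ?A\<close> by fast+
    ultimately show "\<Union>C \<in> ?A"
      by blast
  qed
  then obtain P where PA: "P \<in> ?A" "\<forall>X\<in>?A. P \<subseteq> X \<longrightarrow> X = P"
    by (elim bexE)
  then have P: "ideal P R" "J \<subseteq> P" "P \<inter> S = {}"
    by simp_all
  have max: "X = P" if "ideal X R" "J \<subseteq> X" "X \<inter> S = {}" "P \<subseteq> X" for X
    using PA(2) that by simp
  interpret P: ideal P R by fact
  \<comment> \<open>If \<open>a\<close> lies outside \<open>P\<close>, the ideal generated by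
    \<open>P\<close> and \<open>a\<close> is strictly larger, so by maximality it must meet
    \<open>S\<close>.\<close>
  have meets: "\<exists>p\<in>P. \<exists>r\<in>carrier R. p \<oplus> r \<otimes> a \<in> S"
    if a: "a \<in> carrier R" "a \<notin> P" for a
  proof (rule ccontr)
    assume no: "\<not> ?thesis"
    let ?X = "P <+>\<^bsub>R\<^esub> PIdl a"
    have X: "ideal ?X R"
      using P(1) cgenideal_ideal[OF a(1)] by (rule add_ideals)
    have X_eq: "?X = {p \<oplus> r \<otimes> a | p r. p \<in> P \<and> r \<in> carrier R}"
      unfolding set_add_def' cgenideal_def by blast
    have "P \<subseteq> ?X"
    proof
      fix p assume "p \<in> P"
      moreover from this have "p = p \<oplus> \<zero> \<otimes> a"
        using a P.Icarr by simp
      ultimately show "p \<in> ?X"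
        unfolding X_eq by blast
    qed
    moreover have "?X \<inter> S = {}"
      using no unfolding X_eq by blast
    ultimately have "?X = P"
      using max[OF X] P(2) by blast
    moreover have "a = \<zero> \<oplus> \<one> \<otimes> a"
      using a by simp
    then have "a \<in> ?X"
      unfolding X_eq using P.zero_closed by blast
    ultimately show False
      using a(2) by simp
  qed
  have "primeideal P R"
  proof (rule primeidealI[OF P(1) is_cring])
    show "carrier R \<noteq> P"
      using assms(3,4) P(3) by blast
    fix a b assume ab: "a \<in> carrier R" "b \<in> carrier R" "a \<otimes> b \<in> P"
    show "a \<in> P \<or> b \<in> P"
    proof (rule ccontr)
      assume "\<not> ?thesis"
      then obtain p r q t where *: "p \<in> P" "r \<in> carrier R" "p \<oplus> r \<otimes> a \<in> S"
        "q \<in> P" "t \<in> carrier R" "q \<oplus> t \<otimes> b \<in> S"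
        using meets ab by metis
      note car = *(2,5) ab(1,2) P.Icarr[OF *(1)] P.Icarr[OF *(4)]
      \<comment> \<open>The product of the two elements of \<open>S\<close> is again in
        \<open>S\<close>, but each summand of its expansion contains \<open>p\<close>,
        \<open>q\<close> or \<open>a \<otimes> b\<close>, so it also lies in
        \<open>P\<close>.\<close>
      have "(p \<oplus> r \<otimes> a) \<otimes> (q \<oplus> t \<otimes> b) =
          p \<otimes> (q \<oplus> t \<otimes> b) \<oplus> ((r \<otimes> a) \<otimes> q \<oplus> (r \<otimes> t) \<otimes> (a \<otimes> b))"
        using car by algebra
      also have "\<dots> \<in> P"
        using car * ab by (simp add: P.a_closed P.I_r_closed P.I_l_closed)
      finally show False
        using S_mult[OF *(3,6)] P(3) by blast
    qed
  qed
  with P that show ?thesis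
    by blast
qed

lemma (in primeideal) subproduct_memE:
  assumes "set xs \<subseteq> carrier R" "subproduct R xs {..<length xs} \<in> I"
  obtains x where "x \<in> set xs" "x \<in> I"
proof -
  have "\<exists>x\<in>set xs. x \<in> I"
    using assms
  proof (induction xs)
    case Nil
    then have "\<one> \<in> I"
      by simp
    then show ?case
      using I_notcarr one_imp_carrier by simp
  next
    case (Cons x xs)
    then have x: "x \<in> carrier R" "set xs \<subseteq> carrier R"
      by auto
    with Cons.prems(2) have "x \<otimes> subproduct R xs {..<length xs} \<in> I"
      by (simp only: subproduct_Cons)
    then have "x \<in> I \<or> subproduct R xs {..<length xs} \<in> I"
      using x by (intro I_prime) (auto intro: subproduct_closed)
    then show ?case
      using Cons.IH x by auto
  qed
  with that show ?thesis
    by blast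
qed

subsection \<open>Atoms and good atoms\<close>

context "domain"
begin

lemma atoms_carrier: "atoms R \<subseteq> carrier R"
  by (auto simp: atoms_def)

lemma atomD:
  assumes "a \<in> atoms R"
  shows "a \<in> carrier R" "a \<noteq> \<zero>" "a \<notin> Units R"
  using assms ring_irreducibleE[of a] by (auto simp: atoms_def)

text \<open>Allows a unit that witnesses an association to be absorbed into one factor of an atomic
  product.\<close>

lemma Units_mult_atom:
  assumes "u \<in> Units R" "a \<in> atoms R"
  shows "u \<otimes> a \<in> atoms R"
proof -
  have a: "a \<in> carrier R" "a \<noteq> \<zero>" "irreducible R a"
    using assms(2) by (auto simp: atoms_def ring_irreducible_def)
  have "u \<in> carrier R" "u \<noteq> \<zero>"
    using assms(1) by (auto simp: Units_def)
  then have "irreducible R (u \<otimes> a)" "u \<otimes> a \<noteq> \<zero>"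
    using a assms(1) integral_iff by (auto intro: irreducible_prod_lI)
  with a \<open>u \<in> carrier R\<close> show ?thesis
    by (simp add: atoms_def ring_irreducible_def)
qed

lemma subproduct_atoms_nonzero:
  assumes "set xs \<subseteq> atoms R"
  shows "subproduct R xs {..<length xs} \<noteq> \<zero>"
  using assms
proof (induction xs)
  case Nil
  then show ?case by simp
next
  case (Cons x xs)
  then have x: "x \<in> carrier R" "x \<noteq> \<zero>" "set xs \<subseteq> carrier R"
    using atomD atoms_carrier by auto
  have "x \<otimes> subproduct R xs {..<length xs} \<noteq> \<zero>"
    using Cons x by (auto simp: integral_iff subproduct_closed)
  with x show ?case
    by (simp only: subproduct_Cons not_False_eq_True)
qed

lemma subproduct_atoms_nonunit:
  assumes "set xs \<subseteq> atoms R" "xs \<noteq> []"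
  shows "subproduct R xs {..<length xs} \<notin> Units R"
proof -
  obtain x ys where xs: "xs = x # ys"
    using assms(2) by (cases xs) auto
  have x: "x \<in> carrier R" "x \<notin> Units R" "set ys \<subseteq> carrier R"
    using assms(1) atomD atoms_carrier by (auto simp: xs)
  then have "x \<otimes> subproduct R ys {..<length ys} \<notin> Units R"
    using unit_factor[of x "subproduct R ys {..<length ys}"] by (auto simp: subproduct_closed)
  with x show ?thesis
    unfolding xs by (simp only: subproduct_Cons not_False_eq_True)
qed

text \<open>Writing \<open>a\<close> as a unit times \<open>b\<close> and cancelling
  \<open>b\<close> leaves that unit between \<open>c\<close> and \<open>d\<close>. This will pass
  from associated subproducts to their complements.\<close>

lemma associated_cancel:
  assumes "a \<in> carrier R" "b \<in> carrier R" "c \<in> carrier R" "d \<in> carrier R"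
    and "b \<noteq> \<zero>" "a \<sim> b" "a \<otimes> c = b \<otimes> d"
  shows "c \<sim> d"
proof -
  obtain u where u: "u \<in> Units R" "a = u \<otimes> b"
    using assms(1,2,6) ring_associated_iff by blast
  then have "b \<otimes> (u \<otimes> c) = b \<otimes> d"
    using assms by (metis Units_closed m_assoc m_comm)
  then have "d = u \<otimes> c"
    using u assms m_lcancel[of b] by auto
  then have "d \<sim> c"
    using u assms ring_associated_iff by blast
  then show ?thesis
    by (simp add: associated_def)
qed

text \<open>
  The hypothesis is stated up to association because splitting off an associated subproduct
  leaves complements that are only associated; the unit is moved into the first factor of
  the right-hand side, where goodness is not required.
\<close>

lemma good_atomic_equality_balanced:
  assumes "as \<noteq> []" "bs \<noteq> []" "\<forall>a\<in>set as. good_atom R a" "set bs \<subseteq> atoms R"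
    and "subproduct R as {..<length as} \<sim> subproduct R bs {..<length bs}"
  shows "length as = length bs"
  using assms
proof (induction "length as" arbitrary: as bs rule: less_induct)
  case less
  have as_atoms: "set as \<subseteq> atoms R"
    using less.prems(3) by (auto simp: good_atom_def)
  obtain b bt where bs: "bs = b # bt"
    using less.prems(2) by (cases bs) auto
  have b: "b \<in> atoms R" "b \<in> carrier R" "set bt \<subseteq> atoms R" "set bt \<subseteq> carrier R"
    using less.prems(4) atoms_carrier by (auto simp: bs)
  have carr: "set as \<subseteq> carrier R" "set bs \<subseteq> carrier R"
    using as_atoms less.prems(4) atoms_carrier by auto
  obtain u where u: "u \<in> Units R"
    "subproduct R as {..<length as} = u \<otimes> subproduct R bs {..<length bs}"
    using less.prems(5) ring_associated_iff carr by (meson subproduct_closed order_refl)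
  \<comment> \<open>\<open>atomic_equality\<close> asks for equality on the nose, which
    \<open>cs\<close> restores without changing the length.\<close>
  define cs where "cs = (u \<otimes> b) # bt"
  have cs: "set cs \<subseteq> atoms R" "cs \<noteq> []" "length cs = length bs"
    using b Units_mult_atom[OF u(1)] by (auto simp: cs_def bs)
  have cs_carr: "set cs \<subseteq> carrier R"
    using cs(1) atoms_carrier by auto
  have ub: "u \<in> carrier R" "u \<otimes> b \<in> carrier R"
    using u(1) b by auto
  have eq: "subproduct R as {..<length as} = subproduct R cs {..<length cs}"
    unfolding u(2) cs_def bs subproduct_Cons[OF ub(2) b(4)] subproduct_Cons[OF b(2,4)]
    using ub b by (simp add: m_assoc subproduct_closed)
  have ae: "atomic_equality R as cs"
    using less.prems(1) as_atoms cs eq by (simp add: atomic_equality_def)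
  show ?case
  proof (cases "irredundant R as cs")
    case True
    \<comment> \<open>One good atom in an irredundant equality is enough to make it balanced; the
      head of \<open>as\<close> serves.\<close>
    have "\<not> bad_atom R (hd as)"
      using less.prems(1,3) by (auto simp: good_atom_def)
    then have "balanced as cs"
      using ae True less.prems(1) unfolding bad_atom_def by (meson UnI1 hd_in_set)
    then show ?thesis
      using cs by (simp add: balanced_def)
  next
    case False
    then obtain I J where I: "I \<noteq> {}" "I \<subset> {..<length as}" and J: "J \<noteq> {}" "J \<subset> {..<length cs}"
      and IJ: "subproduct R as I \<sim> subproduct R cs J"
      unfolding irredundant_def by blast
    let ?I = "{..<length as} - I" and ?J = "{..<length cs} - J"
    have sub: "I \<subseteq> {..<length as}" "J \<subseteq> {..<length cs}" "?I \<subseteq> {..<length as}" "?J \<subseteq> {..<length cs}"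
      using I J by auto
    have fin: "finite I" "finite J"
      using sub finite_subset by blast+
    obtain xs where xs: "length xs = card I" "set xs \<subseteq> set as"
      "subproduct R xs {..<length xs} = subproduct R as I"
      using subproduct_as_list[OF carr(1) sub(1)] .
    obtain xs' where xs': "length xs' = card ?I" "set xs' \<subseteq> set as"
      "subproduct R xs' {..<length xs'} = subproduct R as ?I"
      using subproduct_as_list[OF carr(1) sub(3)] .
    obtain ys where ys: "length ys = card J" "set ys \<subseteq> set cs"
      "subproduct R ys {..<length ys} = subproduct R cs J"
      using subproduct_as_list[OF cs_carr sub(2)] .
    obtain ys' where ys': "length ys' = card ?J" "set ys' \<subseteq> set cs"
      "subproduct R ys' {..<length ys'} = subproduct R cs ?J"
      using subproduct_as_list[OF cs_carr sub(4)] .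
    \<comment> \<open>Cancelling the associated parts over \<open>I\<close> and \<open>J\<close>
      from the full equality makes the complementary parts associated too, so both halves have the
      form of the induction hypothesis.\<close>
    have "subproduct R cs J \<noteq> \<zero>"
      using subproduct_atoms_nonzero[of ys] ys cs(1) by auto
    moreover have "subproduct R as I \<otimes> subproduct R as ?I = subproduct R cs J \<otimes> subproduct R cs ?J"
      using eq subproduct_Un_complement[OF carr(1) sub(1)]
        subproduct_Un_complement[OF cs_carr sub(2)] by simp
    ultimately have IJ': "subproduct R as ?I \<sim> subproduct R cs ?J"
      by (intro associated_cancel[OF subproduct_closed[OF carr(1) sub(1)]
            subproduct_closed[OF cs_carr sub(2)] subproduct_closed[OF carr(1) sub(3)]
            subproduct_closed[OF cs_carr sub(4)] _ IJ])
    \<comment> \<open>Since \<open>I\<close> and \<open>J\<close> are nonempty and proper, all four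
      pieces are nonempty and both left-hand pieces are strictly shorter than
      \<open>as\<close>.\<close>
    have card_pos: "0 < card I" "0 < card J" "0 < card ?I" "0 < card ?J"
      using I J fin by (auto simp: card_gt_0_iff)
    have card_sum: "card I + card ?I = length as" "card J + card ?J = length cs"
      using card_mono[OF _ sub(1)] card_mono[OF _ sub(2)] fin sub
      by (simp_all add: card_Diff_subset)
    have "length xs = length ys"
      using card_pos card_sum xs ys IJ less.prems(3) cs(1)
      by (intro less.hyps) (auto simp flip: length_greater_0_conv)
    moreover have "length xs' = length ys'"
      using card_pos card_sum xs' ys' IJ' less.prems(3) cs(1)
      by (intro less.hyps) (auto simp flip: length_greater_0_conv)
    ultimately show ?thesis
      using card_sum xs(1) ys(1) xs'(1) ys'(1) cs(3) by linarith
  qed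
qed

end

section \<open>Half-factorial domains have only good atoms\<close>

lemma (in half_factorial_domain) atoms_good:
  assumes "a \<in> atoms R"
  shows "good_atom R a"
proof -
  have "length as = length bs" if ae: "atomic_equality R as bs" for as bs
  proof (rule factorization_length_unique)
    let ?x = "subproduct R as {..<length as}"
    have as: "set as \<subseteq> atoms R" "as \<noteq> []"
      using ae by (auto simp: atomic_equality_def)
    then show "?x \<in> carrier R" "?x \<noteq> \<zero>" "?x \<notin> Units R"
      using atoms_carrier subproduct_atoms_nonzero subproduct_atoms_nonunit
      by (auto intro!: subproduct_closed)
    show "atomic_factorization R as ?x" "atomic_factorization R bs ?x"
      using ae by (auto simp: atomic_equality_def atomic_factorization_def)
  qed
  then show ?thesis
    using assms by (auto simp: good_atom_def bad_atom_def balanced_def)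
qed

section \<open>From good atoms in prime ideals to unique factorization lengths\<close>

context atomic_domain
begin

text \<open>A nonzero element of \<open>P\<close> is a nonunit because \<open>P\<close> is proper;
  by primality one factor of an atomic factorization of it lies in \<open>P\<close>.\<close>

lemma primeideal_contains_atom:
  assumes "primeideal P R" "P \<noteq> {\<zero>}"
  obtains a where "a \<in> P" "a \<in> atoms R"
proof -
  interpret P: primeideal P R by fact
  obtain x where x: "x \<in> P" "x \<noteq> \<zero>"
    using assms(2) P.zero_closed by blast
  have "x \<in> carrier R"
    using x P.Icarr by blast
  moreover have "x \<notin> Units R"
    using x(1) P.I_notcarr P.I_l_closed P.one_imp_carrier Units_l_inv Units_inv_closed by metis
  ultimately obtain as where "set as \<subseteq> atoms R" "subproduct R as {..<length as} = x"
    using atomic_factorization_exists x(2) unfolding atomic_factorization_def by blast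
  then show ?thesis
    using P.subproduct_memE[of as] atoms_carrier x(1) that by blast
qed

lemma divides_product_of_good_atoms:
  assumes good: "\<And>P. \<lbrakk>primeideal P R; P \<noteq> {\<zero>}\<rbrakk> \<Longrightarrow> \<exists>a\<in>P. good_atom R a"
    and x: "x \<in> carrier R" "x \<noteq> \<zero>"
  obtains y gs where "y \<in> carrier R" "\<forall>g\<in>set gs. good_atom R g"
    "x \<otimes> y = subproduct R gs {..<length gs}"
proof -
  define S where "S = {subproduct R gs {..<length gs} | gs. \<forall>g\<in>set gs. good_atom R g}"
  have good_carr: "set gs \<subseteq> carrier R" if "\<forall>g\<in>set gs. good_atom R g" for gs
    using that atoms_carrier by (auto simp: good_atom_def)
  have S_mult: "s \<otimes> t \<in> S" if st: "s \<in> S" "t \<in> S" for s t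
  proof -
    obtain gs hs where gs: "s = subproduct R gs {..<length gs}" "\<forall>g\<in>set gs. good_atom R g"
      and hs: "t = subproduct R hs {..<length hs}" "\<forall>g\<in>set hs. good_atom R g"
      using st unfolding S_def by blast
    have "s \<otimes> t = subproduct R (gs @ hs) {..<length (gs @ hs)}"
      using subproduct_append[of gs hs] good_carr gs hs by simp
    moreover have "\<forall>g\<in>set (gs @ hs). good_atom R g"
      using gs hs by auto
    ultimately show ?thesis
      unfolding S_def by blast
  qed
  have S_carr: "S \<subseteq> carrier R"
    using good_carr by (auto simp: S_def intro: subproduct_closed)
  have S_one: "\<one> \<in> S"
    unfolding S_def by (intro CollectI exI[of _ "[]"]) simp
  have "PIdl x \<inter> S \<noteq> {}"
  proof
    assume "PIdl x \<inter> S = {}"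
    then obtain P where P: "primeideal P R" "PIdl x \<subseteq> P" "P \<inter> S = {}"
      using exists_primeideal_disjoint[OF cgenideal_ideal[OF x(1)] _ S_carr S_one S_mult] by blast
    have "x \<in> P"
      using P(2) cgenideal_self[OF x(1)] by blast
    then obtain a where a: "a \<in> P" "good_atom R a"
      using good P(1) x(2) by blast
    have "a \<in> carrier R"
      using a(2) atoms_carrier by (auto simp: good_atom_def)
    \<comment> \<open>A good atom is a product with one factor, so the one found in \<open>P\<close>
      contradicts the disjointness of \<open>P\<close> and \<open>S\<close>.\<close>
    then have "a = subproduct R [a] {..<length [a]}"
      using subproduct_Cons[of a "[]"] by simp
    moreover have "\<forall>g\<in>set [a]. good_atom R g"
      using a(2) by simp
    ultimately have "a \<in> S"
      unfolding S_def by blast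
    with a(1) P(3) show False
      by blast
  qed
  then obtain y gs where "y \<in> carrier R" "\<forall>g\<in>set gs. good_atom R g"
    "y \<otimes> x = subproduct R gs {..<length gs}"
    unfolding S_def cgenideal_def by auto
  with that show ?thesis
    using x m_comm by metis
qed

lemma factorization_length_unique_if_good:
  assumes good: "\<And>P. \<lbrakk>primeideal P R; P \<noteq> {\<zero>}\<rbrakk> \<Longrightarrow> \<exists>a\<in>P. good_atom R a"
    and x: "x \<in> carrier R" "x \<noteq> \<zero>" "x \<notin> Units R"
    and "atomic_factorization R as x" "atomic_factorization R bs x"
  shows "length as = length bs"
proof -
  obtain y gs where y: "y \<in> carrier R" and gs: "\<forall>g\<in>set gs. good_atom R g"
    "x \<otimes> y = subproduct R gs {..<length gs}"
    using divides_product_of_good_atoms[OF good x(1,2)] by blast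
  have "set gs \<subseteq> atoms R"
    using gs(1) by (auto simp: good_atom_def)
  \<comment> \<open>An empty \<open>gs\<close> would give \<open>x \<otimes> y = \<one>\<close>,
    making \<open>x\<close> a unit.\<close>
  have "gs \<noteq> []"
    using gs(2) unit_factor[of x y] x y by auto
  have "x \<otimes> y \<noteq> \<zero>"
    using subproduct_atoms_nonzero[OF \<open>set gs \<subseteq> atoms R\<close>] gs(2) by simp
  then have "y \<noteq> \<zero>"
    using x by auto
  \<comment> \<open>Association instead of equality covers a unit \<open>y\<close>, for which
    \<open>cs\<close> is the empty list.\<close>
  have "\<exists>cs. set cs \<subseteq> atoms R \<and> subproduct R cs {..<length cs} \<sim> y"
  proof (cases "y \<in> Units R")
    case True
    then have "\<one> \<sim> y"
      using y by (intro associatedI) (auto simp: one_divides divides_one)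
    then show ?thesis
      by (intro exI[of _ "[]"]) simp
  next
    case False
    then show ?thesis
      using atomic_factorization_exists[OF y \<open>y \<noteq> \<zero>\<close>] y unfolding atomic_factorization_def
      by (metis associated_refl)
  qed
  then obtain cs where cs: "set cs \<subseteq> atoms R" "subproduct R cs {..<length cs} \<sim> y"
    by blast
  \<comment> \<open>Neither \<open>gs\<close> nor \<open>cs\<close> depends on \<open>ds\<close>, so
    the length of \<open>ds\<close> is the same for every factorization of \<open>x\<close>.\<close>
  have "length gs = length (ds @ cs)" if "atomic_factorization R ds x" for ds
  proof (rule good_atomic_equality_balanced)
    have ds: "set ds \<subseteq> atoms R" "subproduct R ds {..<length ds} = x"
      using that by (auto simp: atomic_factorization_def)
    show "ds @ cs \<noteq> []"
      using ds(2) x(3) by auto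
    show "set (ds @ cs) \<subseteq> atoms R"
      using ds cs by auto
    have carr: "set ds \<subseteq> carrier R" "set cs \<subseteq> carrier R"
      using ds cs atoms_carrier by auto
    have "x \<otimes> subproduct R cs {..<length cs} \<sim> x \<otimes> y"
      using cs(2) x(1) y carr(2) unfolding associated_def
      by (auto intro: divides_mult subproduct_closed)
    then have "subproduct R (ds @ cs) {..<length (ds @ cs)} \<sim> x \<otimes> y"
      using subproduct_append[OF carr] ds(2) by simp
    then show "subproduct R gs {..<length gs} \<sim> subproduct R (ds @ cs) {..<length (ds @ cs)}"
      using gs(2) by (simp add: associated_def)
  qed (use gs(1) \<open>gs \<noteq> []\<close> in auto)
  from this[OF assms(5)] this[OF assms(6)] show ?thesis
    by simp
qed

end

theorem theorem4:
  fixes A (structure)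
  assumes "atomic_domain A"
  shows "half_factorial_domain A \<longleftrightarrow>
    (\<forall>P. primeideal P A \<and> P \<noteq> {\<zero>} \<longrightarrow> (\<exists>a\<in>P. good_atom A a))"
proof
  interpret atomic_domain A by fact
  show "\<forall>P. primeideal P A \<and> P \<noteq> {\<zero>} \<longrightarrow> (\<exists>a\<in>P. good_atom A a)" if "half_factorial_domain A"
    using half_factorial_domain.atoms_good[OF that] primeideal_contains_atom by metis
  show "half_factorial_domain A"
    if "\<forall>P. primeideal P A \<and> P \<noteq> {\<zero>} \<longrightarrow> (\<exists>a\<in>P. good_atom A a)"
  proof
    show "length as = length bs"
      if "x \<in> carrier A" "x \<noteq> \<zero>" "x \<notin> Units A"
        "atomic_factorization A as x" "atomic_factorization A bs x" for x as bs
      using factorization_length_unique_if_good[OF _ that]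
        \<open>\<forall>P. primeideal P A \<and> P \<noteq> {\<zero>} \<longrightarrow> (\<exists>a\<in>P. good_atom A a)\<close> by blast
  qed
qed

end
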